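(* Let $N\geq 2$, $1<p<N$, $p^\star:=\frac{Np}{N-p}$, and let $\mathcal{S}_{N,p}$ be the optimal constant in the Sobolev inequality $\mathcal{S}_{N,p}\|u\|_{L^{p^\star}(\mathbb{R}^N)}\leq\|\nabla u\|_{L^p(\mathbb{R}^N)}$ for all $u\in W^{1,p}(\mathbb{R}^N)$. Then $$\mathcal{S}_{N,p}\leq\sqrt{\pi}\,N^{\frac1p}\left(\frac{N-p}{p-1}\right)^{\frac{p-1}{p}}\frac{(p^\star-1)^{\frac{p-1}{p}}}{\Gamma(1+N/2)^{\frac1N}}.$$
   Context: $\Gamma(t)=\int_0^\infty s^{t-1}e^{-s}\,ds$ is the Gamma function. Optimal means that $\mathcal{S}_{N,p}$ is the largest constant for which the Sobolev inequality holds. It is known (Aubin, Talenti) that $$\mathcal{S}_{N,p}=\sqrt{\pi}N^{\frac1p}\left(\frac{N-p}{p-1}\right)^{\frac{p-1}{p}}\left(\frac{\Gamma(N/p)\Gamma(1+N-N/p)}{\Gamma(1+N/2)\Gamma(N)}\right)^{\frac1N},$$ and that for every open set $\Omega\subset\mathbb{R}^N$ one has $\mathcal{S}_{N,p}^p=\inf\{\|\nabla u\|_{L^p(\Omega)}^p/\|u\|_{L^{p^\star}(\Omega)}^p: u\in W_0^{1,p}(\Omega)\setminus\{0\}\}$. *)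

theory Defs
  imports "HOL-Analysis.Analysis"
begin

definition partial_deriv :: "'n::finite \<Rightarrow> (real^'n \<Rightarrow> real) \<Rightarrow> real^'n \<Rightarrow> real" where
  "partial_deriv i f x = frechet_derivative f (at x) (axis i 1)"

(* f is of class C^(k+1) iff it is differentiable everywhere and all its first partial
   derivatives are of class C^k. *)
primrec class_C :: "nat \<Rightarrow> (real^'n::finite \<Rightarrow> real) \<Rightarrow> bool" where
  "class_C 0 f \<longleftrightarrow> continuous_on UNIV f"
| "class_C (Suc k) f \<longleftrightarrow> (\<forall>x. f differentiable (at x)) \<and> (\<forall>i. class_C k (partial_deriv i f))"

definition test_functions :: "(real^'n::finite \<Rightarrow> real) set" where
  "test_functions = {\<phi>. (\<forall>k. class_C k \<phi>) \<and> compact (closure {x. \<phi> x \<noteq> 0})}"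

(* Weak gradients are determined only up to null sets, hence a relation instead of a function. *)
definition has_weak_gradient ::
    "(real^'n::finite \<Rightarrow> real) \<Rightarrow> (real^'n \<Rightarrow> real^'n) \<Rightarrow> bool" where
  "has_weak_gradient u g \<longleftrightarrow>
     (\<forall>K. compact K \<longrightarrow> u absolutely_integrable_on K \<and> g absolutely_integrable_on K) \<and>
     (\<forall>\<phi>\<in>test_functions. \<forall>i.
        (LINT x|lebesgue. u x * partial_deriv i \<phi> x) = - (LINT x|lebesgue. g x $ i * \<phi> x))"

(* The L^q norm with values in [0, \<infinity>]. *)
definition Lp_norm :: "real \<Rightarrow> (real^'n::finite \<Rightarrow> 'b::real_normed_vector) \<Rightarrow> ennreal" where
  "Lp_norm q f =
     (let I = \<integral>\<^sup>+ x. ennreal (norm (f x) powr q) \<partial>lebesgue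
      in if I = \<infinity> then \<infinity> else ennreal (enn2real I powr (1 / q)))"

definition Lp_space :: "real \<Rightarrow> (real^'n::finite \<Rightarrow> 'b::real_normed_vector) set" where
  "Lp_space q = {f. f \<in> borel_measurable lebesgue \<and> Lp_norm q f < \<infinity>}"

definition sobolev_W1 :: "real \<Rightarrow> (real^'n::finite \<Rightarrow> real) set" where
  "sobolev_W1 p = {u \<in> Lp_space p. \<exists>g \<in> Lp_space p. has_weak_gradient u g}"

definition sobolev_exponent :: "nat \<Rightarrow> real \<Rightarrow> real" where
  "sobolev_exponent N p = real N * p / (real N - p)"

definition sobolev_inequality :: "'n::finite itself \<Rightarrow> real \<Rightarrow> real \<Rightarrow> bool" where
  "sobolev_inequality _ p C \<longleftrightarrow>
     (\<forall>u \<in> sobolev_W1 p. \<forall>g :: real^'n \<Rightarrow> real^'n. has_weak_gradient u g \<longrightarrow>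
        ennreal C * Lp_norm (sobolev_exponent CARD('n) p) u \<le> Lp_norm p g)"

(* The inequality is meaningful only for C \<ge> 0, as ennreal truncates negative reals to 0. *)
definition sobolev_const :: "'n::finite itself \<Rightarrow> real \<Rightarrow> real" where
  "sobolev_const T p = (GREATEST C. 0 \<le> C \<and> sobolev_inequality T p C)"

end

theory Submission
  imports Defs
begin

text \<open>
  Any nonzero Sobolev function bounds the optimal constant from above by its Rayleigh quotient, and
  the claimed bound comes from testing with the \<open>p\<close>-torsion function of the unit ball, which is a
  multiple of \<open>u x = 1 - norm x powr r\<close> on the ball, with \<open>r = p / (p - 1)\<close>, and zero outside.

  Let \<open>V\<close> be the volume of the unit ball. The function \<open>u\<close> has integral \<open>V * r / (N + r)\<close>
  (\<open>nn_integral_bump\<close>), and the \<open>p\<close>-th power of the length of its gradient has integral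
  \<open>r powr p * V * N / (N + r)\<close> (\<open>nn_integral_norm_bump_grad_powr\<close>). The norm of \<open>u\<close> with exponent
  \<open>pstar\<close> is not computed but bounded below through the mean of \<open>u\<close> by Jensen's inequality
  (\<open>nn_integral_bump_powr_ge\<close>). As \<open>1 / p - 1 / pstar = 1 / N\<close>, the quotient is then at most
  \<open>V powr (1 / N) * N powr (1 / p) * (N + r) powr ((p - 1) / p)\<close>, which is the right-hand side
  (\<open>sobolev_const_bound_eq\<close>).

  Two points concern the definitions. The pointwise gradient of \<open>u\<close>, which jumps at the unit sphere,
  has to be its weak gradient (\<open>bump_has_weak_gradient\<close>); this follows from the translation
  invariance of the integral. And the optimal constant has to be an attained maximum
  (\<open>sobolev_const_le\<close>); boundedness of the admissible constants, which the test function supplies,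
  is enough for that.
\<close>

section \<open>Lebesgue norms and the optimal constant\<close>

lemma Lp_norm_eq:
  assumes "(\<integral>\<^sup>+ x. ennreal (norm (f x) powr q) \<partial>lebesgue) = ennreal a" "0 \<le> a"
  shows "Lp_norm q f = ennreal (a powr (1 / q))"
  using assms by (simp add: Lp_norm_def Let_def)

lemma Lp_norm_ge:
  assumes "ennreal a \<le> (\<integral>\<^sup>+ x. ennreal (norm (f x) powr q) \<partial>lebesgue)" "0 \<le> a" "0 < q"
  shows "ennreal (a powr (1 / q)) \<le> Lp_norm q f"
proof (cases "(\<integral>\<^sup>+ x. ennreal (norm (f x) powr q) \<partial>lebesgue)" rule: ennreal_cases)
  case (real b)
  then show ?thesis
    using assms Lp_norm_eq[OF real(2)] by (auto intro!: ennreal_leI powr_mono2)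
next
  case top
  then show ?thesis
    by (simp add: Lp_norm_def)
qed

lemma Lp_norm_less_top_iff:
  "Lp_norm q f < \<infinity> \<longleftrightarrow> (\<integral>\<^sup>+ x. ennreal (norm (f x) powr q) \<partial>lebesgue) < \<infinity>"
  by (auto simp: Lp_norm_def Let_def less_top)

lemma ennreal_mult_le_if_all_less:
  fixes a b :: ennreal and c :: real
  assumes less: "\<And>C. 0 \<le> C \<Longrightarrow> C < c \<Longrightarrow> ennreal C * a \<le> b"
  shows "ennreal c * a \<le> b"
proof (cases "c \<le> 0")
  case True
  then show ?thesis
    by (simp add: ennreal_neg)
next
  case False
  show ?thesis
  proof (cases "a = \<infinity>")
    case True
    with less[of "c / 2"] False show ?thesis
      by (simp add: ennreal_mult_top)
  next
    case a: False
    have "((\<lambda>C. ennreal C * a) \<longlongrightarrow> ennreal c * a) (at_left c)"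
      by (intro ennreal_tendsto_cmult tendsto_mult_ennreal tendsto_ennrealI tendsto_intros) (use a False in auto)
    moreover have "\<forall>\<^sub>F C in at_left c. ennreal C * a \<le> b"
      unfolding eventually_at_left_field using False
      by (intro exI[of _ 0]) (auto intro: less)
    ultimately show ?thesis
      by (rule tendsto_upperbound) simp
  qed
qed

text \<open>
  A description by GREATEST says something only if the maximum is attained. It is: the set of
  admissible constants contains 0, it is bounded by assumption, and it contains its supremum
  because the inequality is preserved under limits in the constant. Hence an upper bound can be
  shown without knowing that any positive constant is admissible.
\<close>
lemma sobolev_const_le:
  fixes B :: real
  assumes bound: "\<And>C. 0 \<le> C \<Longrightarrow> sobolev_inequality TYPE('n::finite) p C \<Longrightarrow> C \<le> B"
  shows "sobolev_const TYPE('n) p \<le> B"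
proof -
  let ?P = "\<lambda>C. 0 \<le> C \<and> sobolev_inequality TYPE('n) p C"
  define S where "S = Sup (Collect ?P)"
  have zero: "?P 0"
    by (simp add: sobolev_inequality_def)
  have bdd: "bdd_above (Collect ?P)"
    using bound by (auto simp: bdd_above_def)
  have upper: "C \<le> S" if "?P C" for C
    unfolding S_def by (rule cSup_upper[OF _ bdd]) (use that in simp)
  have "sobolev_inequality TYPE('n) p S"
    unfolding sobolev_inequality_def
  proof (intro ballI allI impI)
    fix u and g :: "real^'n \<Rightarrow> real^'n"
    assume u: "u \<in> sobolev_W1 p" "has_weak_gradient u g"
    show "ennreal S * Lp_norm (sobolev_exponent CARD('n) p) u \<le> Lp_norm p g"
    proof (rule ennreal_mult_le_if_all_less)
      fix C :: real
      assume "0 \<le> C" "C < S"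
      then obtain D where D: "?P D" "C < D"
        using less_cSup_iff[of "Collect ?P" C] zero bdd by (auto simp: S_def)
      then have "ennreal C * Lp_norm (sobolev_exponent CARD('n) p) u
          \<le> ennreal D * Lp_norm (sobolev_exponent CARD('n) p) u"
        by (intro mult_right_mono ennreal_leI) auto
      also have "\<dots> \<le> Lp_norm p g"
        using D u by (simp add: sobolev_inequality_def)
      finally show "ennreal C * Lp_norm (sobolev_exponent CARD('n) p) u \<le> Lp_norm p g" .
    qed
  qed
  with upper[OF zero] have "?P S"
    by simp
  moreover from this upper have "sobolev_const TYPE('n) p = S"
    unfolding sobolev_const_def by (intro Greatest_equality) auto
  ultimately show ?thesis
    using bound by simp
qed

section \<open>The truncated power of the norm\<close>

text \<open>
  For \<open>r = p / (p - 1)\<close> this is, up to a constant factor, the \<open>p\<close>-torsion function of the unit ball,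
  that is, the solution of \<open>- \<Delta>\<^sub>p u = 1\<close> with zero boundary values, extended by zero. The
  truncation sits inside the power because \<open>min 1 (norm x)\<close> is 1-Lipschitz.
\<close>
definition bump :: "real \<Rightarrow> 'a::euclidean_space \<Rightarrow> real" where
  "bump r x = 1 - min 1 (norm x) powr r"

text \<open>
  The factor \<open>x\<close> makes the value at the origin 0 even where the exponent \<open>r - 2\<close> is negative; for
  \<open>1 < r\<close> this is the true gradient there.
\<close>
definition bump_grad :: "real \<Rightarrow> 'a::euclidean_space \<Rightarrow> 'a" where
  "bump_grad r x = (if norm x < 1 then - (r * norm x powr (r - 2)) *\<^sub>R x else 0)"

lemma bump_borel [measurable]: "bump r \<in> borel_measurable borel"
  unfolding bump_def by measurable

lemma bump_grad_borel [measurable]: "bump_grad r \<in> borel_measurable borel"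
  unfolding bump_grad_def by measurable

lemma bump_grad_component_borel [measurable]:
  "(\<lambda>x :: real^'n::finite. bump_grad r x $ i) \<in> borel_measurable borel"
  by (rule measurable_compose[OF bump_grad_borel])
    (intro borel_measurable_continuous_onI continuous_intros)

lemma bump_nonneg: "0 < r \<Longrightarrow> 0 \<le> bump r x"
  by (simp add: bump_def powr_le1)

lemma bump_le_1: "bump r x \<le> 1"
  by (simp add: bump_def)

lemma bump_eq_0: "1 \<le> norm x \<Longrightarrow> bump r x = 0"
  by (simp add: bump_def)

lemma norm_bump_grad: 
  assumes "r > 1"
  shows "norm (bump_grad r x) = r * norm x powr (r - 1) * indicator (ball 0 1) x"
proof (cases "x = 0")
  case False
  then have "norm x powr (r - 2) * norm x = norm x powr (r - 1)"
    by (simp add: powr_mult_base mult.commute)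
  with assms show ?thesis
    by (simp add: bump_grad_def)
qed (simp add: bump_grad_def)

lemma norm_bump_grad_le:
  assumes "r > 1"
  shows "norm (bump_grad r x) \<le> r"
  using assms powr_le1[of "r - 1" "norm x"]
  by (auto simp: norm_bump_grad indicator_def)

text \<open>
  Young's inequality for the product \<open>s * t powr (r - 1)\<close> is the tangent line inequality for the
  convex function \<open>\<lambda>s. s powr r\<close>, valid up to and including the endpoint 0. It yields both the
  Lipschitz bound for the bump and the Jensen inequality for its integral.
\<close>
lemma powr_above_tangent:
  fixes s t r :: real
  assumes r: "1 < r" and "0 \<le> s" "0 \<le> t"
  shows "t powr r + r * t powr (r - 1) * (s - t) \<le> s powr r"
proof -
  have "s * t powr (r - 1) \<le> s powr r / r + (t powr (r - 1)) powr (r / (r - 1)) / (r / (r - 1))"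
    using assms by (intro Youngs_inequality) (auto simp: field_simps)
  also have "(t powr (r - 1)) powr (r / (r - 1)) = t powr r"
    using r by (simp add: powr_powr)
  finally have "r * (s * t powr (r - 1)) \<le> s powr r + (r - 1) * t powr r"
    using r by (simp add: field_simps)
  moreover have "t powr (r - 1) * t = t powr r"
    using assms by (simp add: powr_mult_base mult.commute)
  ultimately show ?thesis
    by (simp add: algebra_simps)
qed

lemma powr_lipschitz_on_unit_interval:
  fixes s t r :: real
  assumes r: "1 < r" and "0 \<le> s" "s \<le> t" "t \<le> 1"
  shows "t powr r - s powr r \<le> r * (t - s)"
proof -
  have "t powr r - s powr r \<le> r * t powr (r - 1) * (t - s)"
    using powr_above_tangent[of r s t] assms by (simp add: algebra_simps)
  also have "\<dots> \<le> r * 1 * (t - s)"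
    using assms by (intro mult_right_mono mult_left_mono powr_le1) auto
  finally show ?thesis
    by simp
qed

lemma bump_lipschitz:
  assumes r: "1 < r"
  shows "\<bar>bump r x - bump r y\<bar> \<le> r * norm (x - y)"
proof -
  have *: "\<bar>bump r x - bump r y\<bar> \<le> r * norm (x - y)" if le: "norm x \<le> norm y" for x y :: 'a
  proof -
    have "min 1 (norm y) powr r - min 1 (norm x) powr r \<le> r * (min 1 (norm y) - min 1 (norm x))"
      using r le by (intro powr_lipschitz_on_unit_interval) auto
    also have "\<dots> \<le> r * norm (x - y)"
      using r le norm_triangle_ineq2[of y x] norm_minus_commute[of x y] by (intro mult_left_mono) auto
    finally show ?thesis
      using r le powr_mono2[of r "min 1 (norm x)" "min 1 (norm y)"]
      by (auto simp: bump_def abs_le_iff)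
  qed
  show ?thesis
  proof (cases "norm x \<le> norm y")
    case True
    then show ?thesis by (rule *)
  next
    case False
    with *[of y x] show ?thesis
      by (simp add: abs_minus_commute norm_minus_commute)
  qed
qed

text \<open>
  The origin is left out, although the bump is differentiable there, because a null set of
  exceptional points is harmless and \<open>norm\<close> is not differentiable at 0.
\<close>
lemma bump_has_derivative:
  assumes r: "1 < r" and "x \<noteq> 0" "norm x \<noteq> 1"
  shows "(bump r has_derivative (\<lambda>h. bump_grad r x \<bullet> h)) (at x)"
proof (cases "norm x < 1")
  case True
  have "((\<lambda>t. 1 - t powr r) has_real_derivative - (r * norm x powr (r - 1))) (at (norm x))"
    using \<open>x \<noteq> 0\<close> by (auto intro!: derivative_eq_intros)
  then have "((\<lambda>t. 1 - t powr r) has_derivative (*) (- (r * norm x powr (r - 1)))) (at (norm x))"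
    unfolding has_field_derivative_def .
  from has_derivative_compose[OF has_derivative_norm[OF \<open>x \<noteq> 0\<close>] this]
  have D: "((\<lambda>x. 1 - norm x powr r) has_derivative
      (\<lambda>h. - (r * norm x powr (r - 1)) * (h \<bullet> sgn x))) (at x)"
    by simp
  have "norm x powr (r - 2) * norm x = norm x powr (r - 1)"
    by (simp add: powr_mult_base mult.commute)
  then have "- (r * norm x powr (r - 1)) * (h \<bullet> sgn x) = bump_grad r x \<bullet> h" for h
    using True \<open>x \<noteq> 0\<close>
    by (auto simp: bump_grad_def sgn_div_norm inner_commute[of h] field_simps)
  with D have "((\<lambda>x. 1 - norm x powr r) has_derivative (\<lambda>h. bump_grad r x \<bullet> h)) (at x)"
    by simp
  then show ?thesis
    by (rule has_derivative_transform_within_open[where s = "ball 0 1"]) 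
       (use True in \<open>auto simp: bump_def\<close>)
next
  case False
  have "((\<lambda>x. 0) has_derivative (\<lambda>h. bump_grad r x \<bullet> h)) (at x)"
    using False by (simp add: bump_grad_def)
  then show ?thesis
    by (rule has_derivative_transform_within_open[where s = "- cball 0 1"]) 
       (use False assms in \<open>auto simp: bump_def\<close>)
qed

section \<open>Integrals of the bump and of its gradient\<close>

text \<open>
  Layer cake: the bump at \<open>x\<close> is the length of the set of \<open>t\<close> in the unit interval with
  \<open>norm x powr r \<le> t\<close>. Exchanging the integrals leaves, for each \<open>t\<close>, the volume of a ball of radius
  \<open>t powr (1 / r)\<close>, and no polar coordinates are needed.
\<close>
lemma nn_integral_bump:
  assumes r: "0 < r"
  shows "(\<integral>\<^sup>+ x. ennreal (bump r x) \<partial>(lborel :: 'a::euclidean_space measure))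
      = ennreal (unit_ball_vol DIM('a) * (r / (real DIM('a) + r)))"
proof -
  let ?N = "real DIM('a)" and ?L = "lborel :: 'a measure"
  have layer: "ennreal (bump r x) = (\<integral>\<^sup>+ t. indicator {0..1} t * indicator {t. norm x powr r \<le> t} t \<partial>lborel)"
    for x :: 'a
  proof -
    have "(\<integral>\<^sup>+ t. indicator {0..1} t * indicator {t. norm x powr r \<le> t} t \<partial>lborel)
        = (\<integral>\<^sup>+ t. indicator {min 1 (norm x) powr r .. 1} t \<partial>lborel :: ennreal)"
    proof (intro nn_integral_cong_AE AE_I[where N = "{1}"])
      \<comment> \<open>Outside the closed ball the first set is empty while the second still contains the endpoint 1.\<close>
      show "{t \<in> space lborel. indicator {0..1} t * indicator {t. norm x powr r \<le> t} t
          \<noteq> (indicator {min 1 (norm x) powr r .. 1} t :: ennreal)} \<subseteq> {1}"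
        using r powr_less_mono2[of r 1 "norm x"] powr_mono2[of r 1 "norm x"]
        by (auto simp: indicator_def min_def split: if_splits intro: order_trans[OF powr_ge_zero])
    qed auto
    also have "\<dots> = ennreal (bump r x)"
      using r by (simp add: bump_def powr_le1)
    finally show ?thesis ..
  qed
  have slice: "(\<integral>\<^sup>+ x. indicator {0..1} t * indicator {t. norm x powr r \<le> t} t \<partial>?L)
      = ennreal (unit_ball_vol ?N * t powr (?N / r)) * indicator {0..1} t" for t :: real
  proof (cases "t \<in> {0..1}")
    case True
    have "(\<integral>\<^sup>+ x. indicator {0..1} t * indicator {t. norm x powr r \<le> t} t \<partial>?L)
        = (\<integral>\<^sup>+ x. indicator (cball 0 (t powr (1 / r))) x \<partial>?L)"
    proof (rule nn_integral_cong)
      fix x :: 'a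
      have "norm x powr r \<le> t \<longleftrightarrow> norm x \<le> t powr (1 / r)"
      proof 
        assume "norm x powr r \<le> t"
        then have "(norm x powr r) powr (1 / r) \<le> t powr (1 / r)"
          using r by (intro powr_mono2) auto
        then show "norm x \<le> t powr (1 / r)" using r by (simp add: powr_powr)
      next
        assume "norm x \<le> t powr (1 / r)"
        then have "norm x powr r \<le> (t powr (1 / r)) powr r"
          using r by (intro powr_mono2) auto
        then show "norm x powr r \<le> t" using r True by (simp add: powr_powr)
      qed
      then show "indicator {0..1} t * indicator {t. norm x powr r \<le> t} t
          = (indicator (cball 0 (t powr (1 / r))) x :: ennreal)"
        using True by (simp add: indicator_def)
    qed
    also have "\<dots> = ennreal (unit_ball_vol ?N * (t powr (1 / r)) ^ DIM('a))"
      by (simp add: emeasure_cball)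
    also have "(t powr (1 / r)) ^ DIM('a) = t powr (?N / r)"
      using powr_realpow'[of "t powr (1 / r)" "DIM('a)"] by (simp add: powr_powr)
    finally show ?thesis
      using True by simp
  qed simp
  have "(\<integral>\<^sup>+ x. ennreal (bump r x) \<partial>?L)
      = (\<integral>\<^sup>+ x. \<integral>\<^sup>+ t. indicator {0..1} t * indicator {t. norm x powr r \<le> t} t \<partial>lborel \<partial>?L)"
    by (simp add: layer)
  also have "\<dots> = (\<integral>\<^sup>+ t. \<integral>\<^sup>+ x. indicator {0..1} t * indicator {t. norm x powr r \<le> t} t \<partial>?L \<partial>lborel)"
    by (rule lborel_pair.Fubini') measurable
  also have "\<dots> = (\<integral>\<^sup>+ t. ennreal (unit_ball_vol ?N * t powr (?N / r)) * indicator {0..1} t \<partial>lborel)"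
    by (simp add: slice)
  also have "\<dots> = ennreal (unit_ball_vol ?N * (1 / (?N / r + 1)))"
  proof (rule nn_integral_has_integral_lebesgue')
    have "((\<lambda>t. t powr (?N / r)) has_integral (1 powr (?N / r + 1) / (?N / r + 1))) {0..1}"
      using r by (intro has_integral_powr_from_0) (auto intro: less_le_trans[of _ 0])
    then show "((\<lambda>t. unit_ball_vol ?N * t powr (?N / r)) has_integral unit_ball_vol ?N * (1 / (?N / r + 1))) {0..1}"
      by (intro has_integral_mult_right) simp
  qed simp
  also have "1 / (?N / r + 1) = r / (?N + r)"
    using r by (simp add: field_simps)
  finally show ?thesis .
qed

lemma bump_le_indicator: "bump r x \<le> indicator (ball 0 1) x"
  by (auto simp: indicator_def bump_le_1 bump_eq_0)

lemma has_bochner_integral_bump: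
  assumes r: "0 < r"
  shows "has_bochner_integral lborel (bump r :: 'a::euclidean_space \<Rightarrow> real)
      (unit_ball_vol DIM('a) * (r / (real DIM('a) + r)))"
  using r by (intro has_bochner_integral_nn_integral nn_integral_bump)
     (auto simp: bump_nonneg)

lemma has_bochner_integral_indicator_ball:
  "has_bochner_integral lborel (indicator (ball 0 1) :: 'a::euclidean_space \<Rightarrow> real)
      (unit_ball_vol DIM('a))"
  using has_bochner_integral_real_indicator[of "ball (0::'a) 1" lborel] emeasure_ball[of 1 "0::'a"]
  by (simp add: content_ball)

text \<open>
  The exponents are conjugate, so \<open>(r - 1) * p = r\<close>: on the unit ball the \<open>p\<close>-th power of the length of
  the gradient is a multiple of \<open>norm x powr r\<close>, which is 1 minus the bump.
\<close>
lemma nn_integral_norm_bump_grad_powr: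
  assumes p: "1 < p" and r: "r = p / (p - 1)"
  shows "(\<integral>\<^sup>+ x. ennreal (norm (bump_grad r x) powr p) \<partial>(lborel :: 'a::euclidean_space measure))
      = ennreal (r powr p * (unit_ball_vol DIM('a) * (real DIM('a) / (real DIM('a) + r))))"
proof -
  let ?N = "real DIM('a)" 
  have r1: "1 < r" "(r - 1) * p = r"
    using p by (auto simp: r field_simps)
  have "norm (bump_grad r x) powr p = r powr p * (indicator (ball 0 1) x - bump r x)" for x :: 'a
    using r1 p by (auto simp: norm_bump_grad bump_def indicator_def powr_mult powr_powr)
  moreover have "has_bochner_integral lborel (\<lambda>x :: 'a. r powr p * (indicator (ball 0 1) x - bump r x))
     (r powr p * (unit_ball_vol ?N - unit_ball_vol ?N * (r / (?N + r))))"
    using r1 by (intro has_bochner_integral_mult_right has_bochner_integral_diff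
      has_bochner_integral_bump has_bochner_integral_indicator_ball) auto
  moreover have "unit_ball_vol ?N - unit_ball_vol ?N * (r / (?N + r)) = unit_ball_vol ?N * (?N / (?N + r))"
    using r1 by (simp add: field_simps)
  ultimately have "has_bochner_integral lborel (\<lambda>x :: 'a. norm (bump_grad r x) powr p)
      (r powr p * (unit_ball_vol ?N * (?N / (?N + r))))"
    by simp
  then show ?thesis
    by (simp add: has_bochner_integral_iff nn_integral_eq_integral)
qed

text \<open>
  Jensen's inequality on the unit ball, where \<open>c\<close> is the mean value of the bump: the tangent line of
  \<open>\<lambda>s. s powr q\<close> at \<open>c\<close> is integrated, and its linear part integrates to zero.
\<close>
lemma nn_integral_bump_powr_ge:
  assumes q: "1 < q" and r: "0 < r"
  defines "c \<equiv> r / (real DIM('a) + r)"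
  shows "ennreal (unit_ball_vol DIM('a) * c powr q)
      \<le> (\<integral>\<^sup>+ x. ennreal (bump r x powr q) \<partial>(lborel :: 'a::euclidean_space measure))"
proof -
  let ?V = "unit_ball_vol DIM('a)" and ?I = "indicator (ball 0 1) :: 'a \<Rightarrow> real"
  have c: "0 < c"
    using r by (simp add: c_def add_nonneg_pos)
  have int: "has_bochner_integral lborel (\<lambda>x. q * c powr (q - 1) * bump r x - (q - 1) * c powr q * ?I x)
     (q * c powr (q - 1) * (?V * c) - (q - 1) * c powr q * ?V)"
    unfolding c_def
    by (intro has_bochner_integral_mult_right has_bochner_integral_diff
      has_bochner_integral_bump has_bochner_integral_indicator_ball r)
  have "c powr (q - 1) * c = c powr q"
    using c by (simp add: powr_mult_base mult.commute)
  then have val: "q * c powr (q - 1) * (?V * c) - (q - 1) * c powr q * ?V = ?V * c powr q"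
    by (simp add: algebra_simps)
  have tangent: "q * c powr (q - 1) * bump r x - (q - 1) * c powr q * ?I x \<le> bump r x powr q" for x
  proof (cases "x \<in> ball 0 1")
    case True
    then show ?thesis
      using powr_above_tangent[OF q bump_nonneg[OF r, of x], of c] c
      by (simp add: algebra_simps flip: \<open>c powr (q - 1) * c = c powr q\<close>)
  qed (auto simp: bump_eq_0)
  have int_powr: "integrable lborel (\<lambda>x :: 'a. bump r x powr q)"
  proof (rule Bochner_Integration.integrable_bound)
    show "integrable lborel ?I"
      using has_bochner_integral_indicator_ball[where 'a = 'a] by (simp add: has_bochner_integral_iff)
    have "norm (bump r x powr q) \<le> norm (?I x)" for x
      using q r bump_nonneg[OF r, of x] bump_le_1[of r x] bump_eq_0[of x r]
      by (cases "norm x < 1") (auto simp: powr_le1)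
    then show "AE x in lborel. norm (bump r x powr q) \<le> norm (?I x)"
      by simp
  qed measurable
  have "?V * c powr q = (\<integral> x. q * c powr (q - 1) * bump r x - (q - 1) * c powr q * ?I x \<partial>lborel)"
    using int by (simp add: has_bochner_integral_iff val)
  also have "\<dots> \<le> (\<integral> x. bump r x powr q \<partial>(lborel :: 'a measure))"
    using int by (intro integral_mono int_powr tangent) (simp add: has_bochner_integral_iff)
  finally show ?thesis
    by (simp add: nn_integral_eq_integral int_powr ennreal_leI)
qed

section \<open>The weak gradient of the bump\<close>

text \<open>
  By translation invariance every difference quotient has integral zero, and dominated convergence
  carries this over to the limit. For a product this is integration by parts in the direction \<open>v\<close>, and
  it avoids slicing the space into lines.
\<close>
lemma integral_limit_difference_quotient_eq_0:
  fixes f :: "'a::euclidean_space \<Rightarrow> real"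
  assumes f: "integrable lborel f" and G: "integrable lborel G"
    and f' [measurable]: "f' \<in> borel_measurable lborel"
    and lim: "AE x in lborel. ((\<lambda>t. (f (x + t *\<^sub>R v) - f x) / t) \<longlongrightarrow> f' x) (at_right 0)"
    and bound: "\<And>x t. 0 < t \<Longrightarrow> t \<le> 1 \<Longrightarrow> \<bar>f (x + t *\<^sub>R v) - f x\<bar> \<le> t * G x"
  shows "(LINT x|lborel. f' x) = 0"
proof -
  have [measurable]: "f \<in> borel_measurable borel"
    using borel_measurable_integrable[OF f] by simp
  define h where "h n = inverse (real (Suc n))" for n
  have h: "0 < h n" "h n \<le> 1" for n
    by (auto simp: h_def field_simps)
  have "filterlim h (at_right 0) sequentially"
    unfolding filterlim_at using h LIMSEQ_inverse_real_of_nat by (auto simp: h_def[abs_def])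
  note hlim = filterlim_compose[OF _ this]
  have "(\<lambda>n. LINT x|lborel. (f (x + h n *\<^sub>R v) - f x) / h n) \<longlonglongrightarrow> (LINT x|lborel. f' x)"
  proof (rule integral_dominated_convergence[OF f' _ G])
    show "AE x in lborel. (\<lambda>n. (f (x + h n *\<^sub>R v) - f x) / h n) \<longlonglongrightarrow> f' x"
      using lim by eventually_elim (rule hlim)
    show "AE x in lborel. norm ((f (x + h n *\<^sub>R v) - f x) / h n) \<le> G x" for n
      using bound[OF h(1) h(2)] h(1)[of n] by (simp add: field_simps)
  qed measurable
  moreover have "(LINT x|lborel. (f (x + h n *\<^sub>R v) - f x) / h n) = 0" for n
  proof -
    have "has_bochner_integral (distr lborel borel ((+) (h n *\<^sub>R v))) f (LINT x|lborel. f x)"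
      using f by (simp add: lborel_distr_plus has_bochner_integral_iff)
    then have shift: "has_bochner_integral lborel (\<lambda>x. f (h n *\<^sub>R v + x)) (LINT x|lborel. f x)"
      by (simp add: has_bochner_integral_iff integrable_distr_eq integral_distr)
    have "has_bochner_integral lborel (\<lambda>x. (f (h n *\<^sub>R v + x) - f x) / h n)
        (((LINT x|lborel. f x) - (LINT x|lborel. f x)) / h n)"
      by (intro has_bochner_integral_divide_zero has_bochner_integral_diff shift)
        (use f in \<open>auto simp: has_bochner_integral_iff\<close>)
    then show ?thesis
      by (simp add: has_bochner_integral_iff add.commute)
  qed
  ultimately show ?thesis
    by (simp only: LIMSEQ_const_iff)
qed

lemma test_function_facts:
  fixes \<phi> :: "real^'n::finite \<Rightarrow> real"
  assumes "\<phi> \<in> test_functions"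
  shows test_function_differentiable: "\<phi> differentiable (at x)"
    and test_function_continuous: "continuous_on S \<phi>"
    and test_function_partial_continuous: "continuous_on S (partial_deriv i \<phi>)"
proof -
  have C: "class_C (Suc 0) \<phi>" "class_C 0 \<phi>"
    using assms by (auto simp: test_functions_def simp del: class_C.simps)
  then show "\<phi> differentiable (at x)" "continuous_on S \<phi>" "continuous_on S (partial_deriv i \<phi>)"
    by (auto intro: continuous_on_subset)
qed

lemma test_function_directional_derivative:
  assumes "\<phi> \<in> test_functions"
  shows "((\<lambda>t. \<phi> (x + t *\<^sub>R axis i 1)) has_real_derivative partial_deriv i \<phi> (x + t *\<^sub>R axis i 1)) (at t)"
proof -
  let ?x = "x + t *\<^sub>R axis i 1"
  have D: "(\<phi> has_derivative frechet_derivative \<phi> (at ?x)) (at ?x)"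
    using test_function_differentiable[OF assms] by (simp add: frechet_derivative_works)
  have "((\<lambda>t. \<phi> (x + t *\<^sub>R axis i 1)) has_derivative (\<lambda>h. frechet_derivative \<phi> (at ?x) (h *\<^sub>R axis i 1))) (at t)"
    by (rule has_derivative_compose[where f = "\<lambda>t. x + t *\<^sub>R axis i 1", OF _ D]) (auto intro!: derivative_eq_intros)
  moreover have "frechet_derivative \<phi> (at ?x) (h *\<^sub>R axis i 1) = partial_deriv i \<phi> ?x * h" for h
    using linear_scale[OF has_derivative_linear[OF D]] by (simp add: partial_deriv_def)
  ultimately show ?thesis
    by (simp add: has_field_derivative_def)
qed

lemma test_function_increment_bound:
  assumes \<phi>: "\<phi> \<in> test_functions"
    and M: "\<And>y. norm y \<le> R + 1 \<Longrightarrow> \<bar>partial_deriv i \<phi> y\<bar> \<le> M"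
    and "0 < t" "t \<le> 1" "norm x \<le> R"
  shows "\<bar>\<phi> (x + t *\<^sub>R axis i 1) - \<phi> x\<bar> \<le> t * M"
proof -
  obtain s where s: "0 < s" "s < t"
    and eq: "\<phi> (x + t *\<^sub>R axis i 1) - \<phi> (x + 0 *\<^sub>R axis i 1) = (t - 0) * partial_deriv i \<phi> (x + s *\<^sub>R axis i 1)"
    using MVT2[OF \<open>0 < t\<close> test_function_directional_derivative[OF \<phi>]] by blast
  have "norm (x + s *\<^sub>R axis i 1) \<le> R + 1"
    using assms s norm_triangle_ineq[of x "s *\<^sub>R axis i 1"] by simp
  from M[OF this] show ?thesis
    using eq \<open>0 < t\<close> by (simp add: abs_mult)
qed

text \<open>
  The difference quotients of the product of the bump and the test function are bounded because both
  factors are Lipschitz near the unit ball, and they converge off the origin and the unit sphere, a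
  null set, to the expression given by the product rule.
\<close>
lemma bump_weak_partial_derivative:
  fixes \<phi> :: "real^'n::finite \<Rightarrow> real"
  assumes r: "1 < r" and \<phi>: "\<phi> \<in> test_functions"
  shows "(LINT x|lborel. bump r x * partial_deriv i \<phi> x) = - (LINT x|lborel. bump_grad r x $ i * \<phi> x)"
proof -
  let ?e = "axis i 1 :: real^'n"
  have [measurable]: "\<phi> \<in> borel_measurable borel" "partial_deriv i \<phi> \<in> borel_measurable borel"
    using \<phi> by (auto intro!: borel_measurable_continuous_onI
        test_function_continuous test_function_partial_continuous)
  have "\<exists>M. \<forall>x \<in> cball 0 3. \<bar>\<psi> x\<bar> \<le> M" if "continuous_on (cball 0 3) \<psi>" for \<psi> :: "real^'n \<Rightarrow> real"
    using compact_imp_bounded[OF compact_continuous_image[OF that compact_cball]]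
    by (auto simp: bounded_iff)
  \<comment> \<open>Quotients with step at most 1 vanish unless \<open>norm x \<le> 2\<close>; then the shifted point has norm at most 3.\<close>
  then obtain M0 M1 where M0: "\<And>x. norm x \<le> 3 \<Longrightarrow> \<bar>\<phi> x\<bar> \<le> M0"
    and M1: "\<And>x. norm x \<le> 3 \<Longrightarrow> \<bar>partial_deriv i \<phi> x\<bar> \<le> M1"
    using test_function_continuous[OF \<phi>] test_function_partial_continuous[OF \<phi>] by (metis mem_cball_0)
  have nonneg: "0 \<le> M0" "0 \<le> M1"
    using M0[of 0] M1[of 0] by auto
  have dom: "integrable lborel (\<lambda>x. c * indicator (cball 0 2) x :: real)" for c
    by (intro integrable_mult_right integrable_real_indicator) (auto intro: emeasure_lborel_cball_finite[unfolded infinity_ennreal_def])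
  have bounded_integrable: "integrable lborel u"
    if [measurable]: "u \<in> borel_measurable borel" and "\<And>x. \<bar>u x\<bar> \<le> c * indicator (cball 0 2) x"
    for u :: "real^'n \<Rightarrow> real" and c
    by (rule Bochner_Integration.integrable_bound[OF dom[of c]])
       (use that order_trans[OF that(2) abs_ge_self] in auto)
  have int1: "integrable lborel (\<lambda>x. bump r x * partial_deriv i \<phi> x)"
  proof (rule bounded_integrable[of _ M1])
    show "\<bar>bump r x * partial_deriv i \<phi> x\<bar> \<le> M1 * indicator (cball 0 2) x" for x
      using r bump_nonneg[of r x] bump_le_1[of r x] bump_eq_0[of x r] M1[of x] nonneg mult_mono[of "bump r x" 1 "\<bar>partial_deriv i \<phi> x\<bar>" M1]
      by (cases "norm x \<le> 1") (auto simp: abs_mult)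
  qed measurable
  have int0: "integrable lborel (\<lambda>x. bump r x * \<phi> x)"
  proof (rule bounded_integrable[of _ M0])
    show "\<bar>bump r x * \<phi> x\<bar> \<le> M0 * indicator (cball 0 2) x" for x
      using r bump_nonneg[of r x] bump_le_1[of r x] bump_eq_0[of x r] M0[of x] nonneg mult_mono[of "bump r x" 1 "\<bar>\<phi> x\<bar>" M0]
      by (cases "norm x \<le> 1") (auto simp: abs_mult)
  qed measurable
  have int2: "integrable lborel (\<lambda>x. bump_grad r x $ i * \<phi> x)"
  proof (rule bounded_integrable[of _ "r * M0"])
    show "\<bar>bump_grad r x $ i * \<phi> x\<bar> \<le> r * M0 * indicator (cball 0 2) x" for x :: "real^'n"
    proof (cases "norm x \<le> 1")
      case True
      have "\<bar>bump_grad r x $ i\<bar> \<le> r"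
        using norm_bump_grad_le[OF r, of x] component_le_norm_cart[of "bump_grad r x" i] by linarith
      then have "\<bar>bump_grad r x $ i\<bar> * \<bar>\<phi> x\<bar> \<le> r * M0"
        using True M0[of x] r by (intro mult_mono) auto
      then show ?thesis
        using True by (simp add: abs_mult)
    next
      case False
      then have "bump_grad r x = 0"
        by (simp add: bump_grad_def)
      then show ?thesis
        using r nonneg by simp
    qed
  qed measurable
  have "(LINT x|lborel. bump_grad r x $ i * \<phi> x + bump r x * partial_deriv i \<phi> x) = 0"
  proof (rule integral_limit_difference_quotient_eq_0[OF int0 dom[of "r * M0 + M1"], where v = ?e])
    have "AE x in lborel. x \<notin> {0} \<union> sphere (0 :: real^'n) 1"
    proof (rule AE_not_in)
      have "sphere (0 :: real^'n) 1 \<in> null_sets lborel"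
        using negligible_sphere[of "0 :: real^'n" 1]
        by (simp add: negligible_iff_null_sets null_sets_completion_iff)
      then show "{0} \<union> sphere (0 :: real^'n) 1 \<in> null_sets lborel"
        by (intro null_sets.Un) auto
    qed
    then show "AE x in lborel. ((\<lambda>t. (bump r (x + t *\<^sub>R ?e) * \<phi> (x + t *\<^sub>R ?e) - bump r x * \<phi> x) / t)
        \<longlongrightarrow> bump_grad r x $ i * \<phi> x + bump r x * partial_deriv i \<phi> x) (at_right 0)"
    proof eventually_elim
      case (elim x)
      then have D: "(bump r has_derivative (\<lambda>h. bump_grad r x \<bullet> h)) (at (x + 0 *\<^sub>R ?e))"
        using bump_has_derivative[OF r, of x] by simp
      have "((\<lambda>t. bump r (x + t *\<^sub>R ?e)) has_derivative (\<lambda>h. bump_grad r x \<bullet> (h *\<^sub>R ?e))) (at 0)"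
        by (rule has_derivative_compose[where f = "\<lambda>t. x + t *\<^sub>R ?e", OF _ D]) (auto intro!: derivative_eq_intros)
      then have "((\<lambda>t. bump r (x + t *\<^sub>R ?e)) has_real_derivative bump_grad r x $ i) (at 0)"
        by (simp add: has_field_derivative_def inner_axis mult.commute[of _ "bump_grad r x $ i"])
      from DERIV_mult[OF this test_function_directional_derivative[OF \<phi>, of x i 0]]
      have "((\<lambda>t. bump r (x + t *\<^sub>R ?e) * \<phi> (x + t *\<^sub>R ?e)) has_real_derivative
          bump_grad r x $ i * \<phi> x + bump r x * partial_deriv i \<phi> x) (at 0)"
        by (simp add: algebra_simps)
      then show ?case
        by (auto simp: DERIV_def intro: tendsto_within_subset)
    qed
    show "\<bar>bump r (x + t *\<^sub>R ?e) * \<phi> (x + t *\<^sub>R ?e) - bump r x * \<phi> x\<bar>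
        \<le> t * ((r * M0 + M1) * indicator (cball 0 2) x)" if t: "0 < t" "t \<le> 1" for x t
    proof (cases "norm x \<le> 2")
      case True
      let ?y = "x + t *\<^sub>R ?e"
      have "norm ?y \<le> 3"
        using True t norm_triangle_ineq[of x "t *\<^sub>R ?e"] by simp
      then have "\<bar>bump r ?y - bump r x\<bar> * \<bar>\<phi> ?y\<bar> \<le> (r * t) * M0"
        using bump_lipschitz[OF r, of ?y x] t r M0 by (intro mult_mono) auto
      moreover have "\<bar>bump r x\<bar> * \<bar>\<phi> ?y - \<phi> x\<bar> \<le> 1 * (t * M1)"
        using bump_nonneg[of r x] bump_le_1[of r x] r t True M1 
        by (intro mult_mono test_function_increment_bound[OF \<phi>, where R = 2]) auto
      moreover have "\<bar>bump r ?y * \<phi> ?y - bump r x * \<phi> x\<bar>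
          \<le> \<bar>bump r ?y - bump r x\<bar> * \<bar>\<phi> ?y\<bar> + \<bar>bump r x\<bar> * \<bar>\<phi> ?y - \<phi> x\<bar>"
        using abs_triangle_ineq[of "(bump r ?y - bump r x) * \<phi> ?y" "bump r x * (\<phi> ?y - \<phi> x)"]
        unfolding abs_mult[symmetric] by (simp add: algebra_simps)
      ultimately show ?thesis
        using True by (simp add: algebra_simps)
    next
      case False
      then have "1 \<le> norm (x + t *\<^sub>R ?e)"
        using t norm_triangle_ineq2[of x "- t *\<^sub>R ?e"] by simp
      with False show ?thesis
        by (simp add: bump_eq_0)
    qed
  qed measurable
  with int1 int2 show ?thesis
    by simp
qed

lemma bounded_borel_absolutely_integrable_on_compact:
  fixes f :: "'a::euclidean_space \<Rightarrow> 'b::euclidean_space"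
  assumes [measurable]: "f \<in> borel_measurable borel"
    and bound: "\<And>x. norm (f x) \<le> M" and K: "compact K"
  shows "f absolutely_integrable_on K"
proof (rule measurable_bounded_by_integrable_imp_absolutely_integrable)
  have "f \<in> borel_measurable lebesgue"
    by (simp add: measurable_completion)
  then show "f \<in> borel_measurable (lebesgue_on K)"
    by (rule measurable_restrict_space1)
  show "K \<in> sets lebesgue"
    using lmeasurable_compact[OF K] by blast
  show "(\<lambda>_. M) integrable_on K"
    using lmeasurable_compact[OF K] by (rule integrable_on_const)
qed (rule bound)

lemma bump_has_weak_gradient:
  assumes r: "1 < r"
  shows "has_weak_gradient (bump r :: real^'n::finite \<Rightarrow> real) (bump_grad r)"
  unfolding has_weak_gradient_def
proof (intro conjI allI impI ballI)
  fix K :: "(real^'n) set"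
  assume K: "compact K"
  have bump_norm: "norm (bump r x) \<le> 1" for x :: "real^'n"
    using r bump_nonneg[of r x] bump_le_1[of r x] by simp
  show "bump r absolutely_integrable_on K"
    by (rule bounded_borel_absolutely_integrable_on_compact[OF bump_borel bump_norm K])
  show "bump_grad r absolutely_integrable_on K"
    by (rule bounded_borel_absolutely_integrable_on_compact[OF bump_grad_borel norm_bump_grad_le[OF r] K])
next
  fix \<phi> :: "real^'n \<Rightarrow> real" and i
  assume \<phi>: "\<phi> \<in> test_functions"
  have [measurable]: "\<phi> \<in> borel_measurable borel" "partial_deriv i \<phi> \<in> borel_measurable borel"
    using \<phi> by (auto intro!: borel_measurable_continuous_onI
        test_function_continuous test_function_partial_continuous)
  show "(LINT x|lebesgue. bump r x * partial_deriv i \<phi> x)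
      = - (LINT x|lebesgue. bump_grad r x $ i * \<phi> x)"
    using bump_weak_partial_derivative[OF r \<phi>, of i] by (simp add: integral_completion)
qed

section \<open>The upper bound\<close>

text \<open>
  The left-hand side is the bound that the torsion function yields. The bases \<open>(n - p) / (p - 1)\<close>
  and \<open>q - 1\<close> multiply to \<open>n + r\<close>, and the powers of \<open>pi\<close> and of the Gamma function form a power of
  the volume of the unit ball.
\<close>
lemma sobolev_const_bound_eq:
  fixes n p q r :: real
  assumes n: "1 < p" "p < n"
    and q: "q = n * p / (n - p)" and r: "r = p / (p - 1)"
  shows "unit_ball_vol n powr (1 / n) * n powr (1 / p) * (n + r) powr ((p - 1) / p)
    = sqrt pi * n powr (1 / p) * ((n - p) / (p - 1)) powr ((p - 1) / p)
        * ((q - 1) powr ((p - 1) / p) / Gamma (1 + n / 2) powr (1 / n))"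
proof -
  have "(n - p) / (p - 1) * (q - 1) = n + r"
    using n by (simp add: q r divide_simps) (simp add: algebra_simps)
  moreover have "0 \<le> q - 1"
  proof -
    have "n - p \<le> n * p"
      using n mult_left_mono[of 1 p n] by linarith
    then show ?thesis
      using n by (simp add: q)
  qed
  ultimately have *: "(n + r) powr ((p - 1) / p)
      = ((n - p) / (p - 1)) powr ((p - 1) / p) * (q - 1) powr ((p - 1) / p)"
    using n powr_mult[of "(n - p) / (p - 1)" "q - 1" "(p - 1) / p"] by simp
  have "unit_ball_vol n powr (1 / n) = sqrt pi / Gamma (1 + n / 2) powr (1 / n)"
    using n by (simp add: unit_ball_vol_def powr_divide Gamma_real_pos less_imp_le powr_powr powr_half_sqrt add.commute)
  then show ?thesis
    by (simp add: *)
qed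

theorem mainTheorem6:
  fixes N :: nat and p pstar :: real
  assumes "N = CARD('n::finite)"
    and "N \<ge> 2"
    and "1 < p" and "p < real N"
    and "pstar = sobolev_exponent N p"
  shows "sobolev_const TYPE('n) p
    \<le> sqrt pi * real N powr (1 / p) * ((real N - p) / (p - 1)) powr ((p - 1) / p)
        * ((pstar - 1) powr ((p - 1) / p) / Gamma (1 + real N / 2) powr (1 / real N))"
proof -
  define r where "r = p / (p - 1)"
  define n where "n = real N"
  define V where "V = unit_ball_vol n"
  define c where "c = r / (n + r)"
  have N: "n = real (DIM(real^'n))"
    using assms by (simp add: n_def)
  have p: "1 < p" "p < n"
    using assms by (auto simp: n_def)
  have q: "pstar = n * p / (n - p)"
    using assms by (simp add: n_def sobolev_exponent_def)
  have "p < pstar"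
    using p by (simp add: q field_simps)
  then have q1: "1 < pstar"
    using p by simp
  have r: "1 < r"
    using p by (simp add: r_def)
  have pos: "0 < V" "0 < c" "0 < n + r"
    using r p by (auto simp: V_def c_def)

  let ?u = "bump r :: real^'n \<Rightarrow> real" and ?g = "bump_grad r :: real^'n \<Rightarrow> real^'n"
  have norm_grad: "Lp_norm p ?g = ennreal ((r powr p * (V * (n / (n + r)))) powr (1 / p))"
    using nn_integral_norm_bump_grad_powr[where 'a = "real^'n", OF p(1) r_def] pos p
    by (intro Lp_norm_eq) (auto simp: nn_integral_completion V_def N)
  \<comment> \<open>Only here is something lost against the exact Rayleigh quotient.\<close>
  have norm_bump: "ennreal ((V * c powr pstar) powr (1 / pstar)) \<le> Lp_norm pstar ?u"
    using nn_integral_bump_powr_ge[where 'a = "real^'n", OF q1, of r] pos r q1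
    by (intro Lp_norm_ge) (auto simp: nn_integral_completion V_def N c_def bump_nonneg)
  have "?u x powr p \<le> ?u x" for x
    using p r powr_mono'[of 1 p "?u x"] by (simp add: bump_nonneg bump_le_1)
  then have "(\<integral>\<^sup>+ x. ennreal (?u x powr p) \<partial>lborel) \<le> (\<integral>\<^sup>+ x. ennreal (?u x) \<partial>lborel)"
    by (intro nn_integral_mono ennreal_leI)
  also have "\<dots> < \<infinity>"
    using r by (simp add: nn_integral_bump)
  finally have "?u \<in> Lp_space p"
    using r unfolding Lp_space_def Lp_norm_less_top_iff mem_Collect_eq
    by (simp add: nn_integral_completion bump_nonneg measurable_completion)
  moreover have "?g \<in> Lp_space p"
    using norm_grad by (simp add: Lp_space_def measurable_completion)
  moreover have weak: "has_weak_gradient ?u ?g"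
    by (rule bump_has_weak_gradient[OF r])
  ultimately have u: "?u \<in> sobolev_W1 p"
    by (auto simp: sobolev_W1_def)

  have "sobolev_const TYPE('n) p \<le> V powr (1 / n) * n powr (1 / p) * (n + r) powr ((p - 1) / p)"
  proof (rule sobolev_const_le)
    fix C :: real
    assume C: "0 \<le> C" and ineq: "sobolev_inequality TYPE('n) p C"
    have "ennreal (C * (V * c powr pstar) powr (1 / pstar)) \<le> ennreal C * Lp_norm pstar ?u"
      using C norm_bump by (simp add: ennreal_mult mult_left_mono)
    also have "\<dots> \<le> Lp_norm p ?g"
      using ineq u weak assms by (simp add: sobolev_inequality_def)
    finally have "C * (V * c powr pstar) powr (1 / pstar) \<le> (r powr p * (V * (n / (n + r)))) powr (1 / p)"
      by (simp add: norm_grad)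
    also have "(V * c powr pstar) powr (1 / pstar) = V powr (1 / pstar) * c"
      using pos q1 by (simp add: powr_mult powr_powr)
    also have "(r powr p * (V * (n / (n + r)))) powr (1 / p) = r * V powr (1 / p) * (n powr (1 / p) / (n + r) powr (1 / p))"
      using pos p r by (simp add: powr_mult powr_powr powr_divide)
    finally have "C \<le> r * V powr (1 / p) * (n powr (1 / p) / (n + r) powr (1 / p)) / (V powr (1 / pstar) * c)"
      using pos by (subst pos_le_divide_eq) auto
    also have "\<dots> = (V powr (1 / p) / V powr (1 / pstar)) * n powr (1 / p) * ((n + r) / (n + r) powr (1 / p))"
      using r pos by (simp add: c_def mult_ac)
    also have "V powr (1 / p) / V powr (1 / pstar) = V powr (1 / n)"
    proof -
      have "1 / p - 1 / pstar = 1 / n"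
        using p by (simp add: q field_simps)
      then show ?thesis
        by (simp flip: powr_diff)
    qed
    also have "(n + r) / (n + r) powr (1 / p) = (n + r) powr ((p - 1) / p)"
      using pos p powr_diff[of "n + r" 1 "1 / p"] by (simp add: field_simps)
    finally show "C \<le> V powr (1 / n) * n powr (1 / p) * (n + r) powr ((p - 1) / p)" .
  qed
  also have "\<dots> = sqrt pi * n powr (1 / p) * ((n - p) / (p - 1)) powr ((p - 1) / p)
        * ((pstar - 1) powr ((p - 1) / p) / Gamma (1 + n / 2) powr (1 / n))"
    unfolding V_def by (rule sobolev_const_bound_eq[OF p q r_def])
  finally show ?thesis
    by (simp add: n_def)
qed

end
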